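(* Let $n\ge 1$ and $k$ be integers with $3\le k\le 2n-2$. Then the $k$-cut complex $\Delta_k(\mathcal{G}_{2\times n})$ is shellable.
   Context: $\mathcal{G}_{2\times n}$ is the $2\times n$ grid graph with vertices $a_i,b_i$ ($1\le i\le n$) and edges $(a_i,a_{i+1}),(b_i,b_{i+1})$ for $1\le i\le n-1$ and $(a_j,b_j)$ for $1\le j\le n$. For a finite simple graph $G$ and $k\ge 1$, the $k$-cut complex $\Delta_k(G)$ is the simplicial complex whose facets are the complements in $V(G)$ of those subsets $S\subseteq V(G)$ of size $k$ for which the induced subgraph $G[S]$ is disconnected. A simplicial complex is shellable if its facets can be listed in a linear order $F_1,\dots,F_t$ such that for every $2\le j\le t$ the subcomplex $\left(\bigcup_{s=1}^{j-1}\langle F_s\rangle\right)\cap\langle F_j\rangle$ is pure of dimension $\dim\langle F_j\rangle-1$, where $\langle F\rangle$ denotes the simplex with unique facet $F$. *)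

theory Defs
  imports "Graph_Theory.Digraph_Component"
begin

section \<open>Abstract simplicial complexes and shellability\<close>

text \<open>Finite abstract simplicial complexes, given by their sets of faces. The void complex
  \<open>{}\<close> and the complex \<open>{{}}\<close> are both allowed.\<close>

definition simplicial_complex :: "'a set set \<Rightarrow> bool" where
  "simplicial_complex K \<longleftrightarrow>
     finite K \<and> (\<forall>\<sigma>\<in>K. finite \<sigma>) \<and> (\<forall>\<sigma>\<in>K. \<forall>\<tau>. \<tau> \<subseteq> \<sigma> \<longrightarrow> \<tau> \<in> K)"

definition facets :: "'a set set \<Rightarrow> 'a set set" where
  "facets K = {F \<in> K. \<forall>\<sigma>\<in>K. F \<subseteq> \<sigma> \<longrightarrow> \<sigma> = F}"

abbreviation simplex :: "'a set \<Rightarrow> 'a set set" where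
  "simplex F \<equiv> Pow F"

text \<open>Dimensions are integers since \<open>dim {} = -1\<close>.\<close>

definition simplex_dim :: "'a set \<Rightarrow> int" where
  "simplex_dim F = int (card F) - 1"

definition pure_of_dim :: "int \<Rightarrow> 'a set set \<Rightarrow> bool" where
  "pure_of_dim d K \<longleftrightarrow> K \<noteq> {} \<and> (\<forall>F\<in>facets K. simplex_dim F = d)"

text \<open>Shellability in the general (not necessarily pure) sense. The list is indexed from
  \<open>0\<close>, so the condition concerns the indices \<open>j \<ge> 1\<close>.\<close>

definition shelling :: "'a set set \<Rightarrow> 'a set list \<Rightarrow> bool" where
  "shelling K Fs \<longleftrightarrow> distinct Fs \<and> set Fs = facets K \<and>
     (\<forall>j. 1 \<le> j \<and> j < length Fs \<longrightarrow>
        pure_of_dim (simplex_dim (Fs ! j) - 1) ((\<Union>s<j. simplex (Fs ! s)) \<inter> simplex (Fs ! j)))"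

definition shellable :: "'a set set \<Rightarrow> bool" where
  "shellable K \<longleftrightarrow> simplicial_complex K \<and> (\<exists>Fs. shelling K Fs)"


section \<open>Cut complexes\<close>

text \<open>Finite simple graphs are the digraphs satisfying the locale \<open>graph\<close> of the library, that is,
  each edge is represented by its two orientations. The complex generated by the complements of
  the disconnected \<open>k\<close>-sets is intended for \<open>k \<ge> 1\<close>: the library counts the
  null graph as not connected.\<close>

definition cut_complex :: "nat \<Rightarrow> ('a, 'b) pre_digraph \<Rightarrow> 'a set set" where
  "cut_complex k G =
     (\<Union>S\<in>{S. S \<subseteq> verts G \<and> card S = k \<and> \<not> connected (G \<restriction> S)}. simplex (verts G - S))"

lemma simplicial_complex_cut_complex:
  assumes "finite (verts G)"
  shows "simplicial_complex (cut_complex k G)"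
proof -
  have sub: "cut_complex k G \<subseteq> Pow (verts G)"
    by (auto simp: cut_complex_def)
  with assms have "finite (cut_complex k G)" "\<forall>\<sigma>\<in>cut_complex k G. finite \<sigma>"
    by (auto intro: finite_subset)
  then show ?thesis
    unfolding simplicial_complex_def cut_complex_def by blast
qed

lemma facets_cut_complex:
  assumes fin: "finite (verts G)"
  shows "facets (cut_complex k G) =
    (\<lambda>S. verts G - S) ` {S. S \<subseteq> verts G \<and> card S = k \<and> \<not> connected (G \<restriction> S)}"
    (is "_ = ?f ` ?D")
proof -
  have max: "S = T" if "S \<in> ?D" "T \<in> ?D" "?f S \<subseteq> ?f T" for S T
  proof -
    from that have "T \<subseteq> S" "card T = card S" by auto
    moreover have "finite S" using that fin by (auto intro: finite_subset)
    ultimately show ?thesis by (metis card_subset_eq)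
  qed
  show ?thesis
  proof (intro equalityI subsetI)
    fix F assume "F \<in> facets (cut_complex k G)"
    then have F: "F \<in> cut_complex k G" "\<And>\<sigma>. \<sigma> \<in> cut_complex k G \<Longrightarrow> F \<subseteq> \<sigma> \<Longrightarrow> \<sigma> = F"
      by (auto simp: facets_def)
    from F(1) obtain S where S: "S \<in> ?D" "F \<subseteq> ?f S"
      by (auto simp: cut_complex_def)
    then have "?f S \<in> cut_complex k G" by (auto simp: cut_complex_def)
    with F(2) S show "F \<in> ?f ` ?D" by blast
  next
    fix F assume "F \<in> ?f ` ?D"
    then obtain S where S: "S \<in> ?D" "F = ?f S" by blast
    then have "F \<in> cut_complex k G" by (auto simp: cut_complex_def)
    moreover have "\<sigma> = F" if "\<sigma> \<in> cut_complex k G" "F \<subseteq> \<sigma>" for \<sigma>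
    proof -
      from that(1) obtain T where T: "T \<in> ?D" "\<sigma> \<subseteq> ?f T"
        by (auto simp: cut_complex_def)
      have "S = T" by (rule max) (use S T that(2) in auto)
      with S T that(2) show ?thesis by blast
    qed
    ultimately show "F \<in> facets (cut_complex k G)" by (auto simp: facets_def)
  qed
qed


section \<open>The $2 \times n$ grid graph\<close>

datatype grid_vertex = A nat | B nat

definition grid_edges :: "nat \<Rightarrow> (grid_vertex \<times> grid_vertex) set" where
  "grid_edges n =
     {(A i, A (i + 1)) | i. 1 \<le> i \<and> i \<le> n - 1} \<union>
     {(B i, B (i + 1)) | i. 1 \<le> i \<and> i \<le> n - 1} \<union>
     {(A j, B j) | j. 1 \<le> j \<and> j \<le> n}"

definition grid_2xn :: "nat \<Rightarrow> (grid_vertex, grid_vertex \<times> grid_vertex) pre_digraph" where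
  "grid_2xn n = with_proj
     \<lparr> pverts = A ` {1..n} \<union> B ` {1..n}, parcs = grid_edges n \<union> (grid_edges n)\<inverse> \<rparr>"

lemma graph_grid_2xn: "graph (grid_2xn n)"
proof -
  let ?V = "A ` {1..n} \<union> B ` {1..n}" and ?E = "grid_edges n \<union> (grid_edges n)\<inverse>"
  have sub: "?E \<subseteq> ?V \<times> ?V" by (auto simp: grid_edges_def)
  have "finite ?E" by (rule finite_subset[OF sub]) auto
  moreover have "u \<noteq> v" if "(u, v) \<in> ?E" for u v
    using that by (auto simp: grid_edges_def)
  moreover have "sym ?E" by (rule sym_Un_converse)
  ultimately have "pair_graph \<lparr> pverts = ?V, parcs = ?E \<rparr>"
    using sub by unfold_locales (auto simp: symmetric_def)
  then show ?thesis
    unfolding grid_2xn_def by (rule pair_graph.pair_graphD_graph)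
qed

end

theory Submission
  imports Defs
begin

text \<open>The facets of the cut complex are the complements of the disconnected \<open>k\<close>-sets, so the
  shelling condition turns into one on these sets. If \<open>T\<close> precedes \<open>S\<close>, there have to be an
  \<open>x \<in> T - S\<close> and a \<open>y \<in> S\<close> such that \<open>S - y + x\<close> is disconnected and also
  precedes \<open>S\<close>. In the language of the Alexander dual, the squarefree monomial ideal
  generated by the disconnected \<open>k\<close>-sets has linear quotients.

  The order is built by deciding, column by column from the left, which vertices belong to
  \<open>S\<close>. Those \<open>S\<close> that contain the next vertex \<open>v\<close> come before those that do not. This is
  legitimate if every disconnected \<open>S\<close> without \<open>v\<close> can be made to contain it, staying
  disconnected, at the price of an undecided vertex. By \<open>separated_exchange\<close> this works as long
  as the part \<open>W\<close> of \<open>S\<close> up to the column of \<open>v\<close> is connected and at least two vertices of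
  \<open>S\<close> lie further right. The reason is that the only neighbour of \<open>v\<close> to the right is the one
  in its own row. If \<open>v\<close> would glue the two sides of \<open>S\<close> together, this neighbour lies on the
  side away from \<open>W\<close>; then nothing joins \<open>W\<close> to the rest, and removing the neighbour keeps
  \<open>W + v\<close> apart from what remains.

  The decisions stop once the set \<open>P\<close> of chosen vertices is nonempty and cannot be continued to
  the right through two vertices at once: its last column is not full, or so few vertices are
  missing that a set containing both right neighbours of \<open>P\<close> is connected or too large. Every
  choice that avoids the right neighbours of \<open>P\<close> is then disconnected. These choices form a
  uniform family, which comes first, and the remaining sets, each with exactly one right neighbour
  of \<open>P\<close>, may follow in any order (\<open>linear_quotients_almost_interval\<close>). As long as the decisions
  go on, \<open>P\<close> is either empty or connected with a full last column, and at least three vertices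
  are missing; this is the situation that the exchange needs, and it is where \<open>k \<ge> 3\<close> enters,
  namely for \<open>P = {}\<close>.\<close>

section \<open>Linear quotients\<close>

text \<open>For the complements \<open>F\<^sub>i\<close> of the sets in the list this is the shelling condition: it says that
  \<open>F\<^sub>i \<inter> F\<^sub>j\<close> is contained in \<open>F\<^sub>l \<inter> F\<^sub>j = F\<^sub>j - {x}\<close>.\<close>

definition linear_quotients :: "'a set set \<Rightarrow> bool" where
  "linear_quotients F \<longleftrightarrow> (\<exists>Ss. distinct Ss \<and> set Ss = F \<and>
     (\<forall>j<length Ss. \<forall>i<j. \<exists>l<j. \<exists>x\<in>Ss ! i. Ss ! l - Ss ! j = {x}))"

lemma linear_quotients_empty: "linear_quotients {}"
  unfolding linear_quotients_def by (intro exI[of _ "[]"]) simp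

lemma linear_quotients_singleton: "linear_quotients {S}"
  unfolding linear_quotients_def by (intro exI[of _ "[S]"]) simp

lemma linear_quotients_Un:
  assumes "linear_quotients F" "linear_quotients G" "F \<inter> G = {}"
    and exch: "\<And>S T. S \<in> G \<Longrightarrow> T \<in> F \<Longrightarrow> \<exists>S'\<in>F. \<exists>x\<in>T. S' - S = {x}"
  shows "linear_quotients (F \<union> G)"
proof -
  obtain Ss where Ss: "distinct Ss" "set Ss = F"
    "\<And>i j. j < length Ss \<Longrightarrow> i < j \<Longrightarrow> \<exists>l<j. \<exists>x\<in>Ss ! i. Ss ! l - Ss ! j = {x}"
    using assms(1) unfolding linear_quotients_def by blast
  obtain Ts where Ts: "distinct Ts" "set Ts = G"
    "\<And>i j. j < length Ts \<Longrightarrow> i < j \<Longrightarrow> \<exists>l<j. \<exists>x\<in>Ts ! i. Ts ! l - Ts ! j = {x}"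
    using assms(2) unfolding linear_quotients_def by blast
  let ?L = "Ss @ Ts" and ?m = "length Ss"
  have "\<exists>l<j. \<exists>x\<in>?L ! i. ?L ! l - ?L ! j = {x}" if j: "j < length ?L" and i: "i < j" for i j
  proof -
    consider "j < ?m" | "i < ?m" "?m \<le> j" | "?m \<le> i" "?m \<le> j" using i by linarith
    then show ?thesis
    proof cases
      case 1
      with i obtain l x where "l < j" "x \<in> Ss ! i" "Ss ! l - Ss ! j = {x}" using Ss(3) by blast
      with 1 i show ?thesis by (intro exI[of _ l]) (auto simp: nth_append)
    next
      case 2
      have "Ts ! (j - ?m) \<in> G" "Ss ! i \<in> F" using 2 j Ss(2) Ts(2) by auto
      then obtain S' x where S': "S' \<in> F" "x \<in> Ss ! i" "S' - Ts ! (j - ?m) = {x}"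
        using exch by blast
      then obtain l where "l < ?m" "S' = Ss ! l" using Ss(2) by (metis in_set_conv_nth)
      with S' 2 show ?thesis by (intro exI[of _ l]) (auto simp: nth_append)
    next
      case 3
      have "j - ?m < length Ts" "i - ?m < j - ?m" using 3 j i by auto
      from Ts(3)[OF this] obtain l x
        where "l < j - ?m" "x \<in> Ts ! (i - ?m)" "Ts ! l - Ts ! (j - ?m) = {x}" by blast
      with 3 show ?thesis by (intro exI[of _ "?m + l"]) (auto simp: nth_append)
    qed
  qed
  then show ?thesis
    unfolding linear_quotients_def using Ss Ts assms(3) by (intro exI[of _ ?L]) auto
qed

text \<open>The counterpart of a shedding vertex in the theory of vertex decomposability: the sets that
  contain \<open>v\<close> come first, and for any of them and any later \<open>S\<close> without \<open>v\<close> the new element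
  \<open>x\<close> is \<open>v\<close> itself.\<close>

lemma linear_quotients_split:
  assumes "linear_quotients {S \<in> F. v \<in> S}" "linear_quotients {S \<in> F. v \<notin> S}"
    and exch: "\<And>S. S \<in> F \<Longrightarrow> v \<notin> S \<Longrightarrow> \<exists>y\<in>S. insert v (S - {y}) \<in> F"
  shows "linear_quotients F"
proof -
  have "linear_quotients ({S \<in> F. v \<in> S} \<union> {S \<in> F. v \<notin> S})"
  proof (rule linear_quotients_Un[OF assms(1,2)])
    fix S T assume S: "S \<in> {S \<in> F. v \<notin> S}" and T: "T \<in> {S \<in> F. v \<in> S}"
    from S exch obtain y where "y \<in> S" "insert v (S - {y}) \<in> F" by auto
    moreover have "insert v (S - {y}) - S = {v}" using S by auto
    ultimately show "\<exists>S'\<in>{S \<in> F. v \<in> S}. \<exists>x\<in>T. S' - S = {x}" using T by blast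
  qed auto
  moreover have "{S \<in> F. v \<in> S} \<union> {S \<in> F. v \<notin> S} = F" by auto
  ultimately show ?thesis by simp
qed

text \<open>The sets of \<open>G\<close> can be appended in any order, since the set that witnesses the condition for
  \<open>T\<close> and \<open>S\<close> is \<open>T\<close> itself or belongs to \<open>F\<close>, hence precedes \<open>S\<close> in any case.\<close>

lemma linear_quotients_extend:
  assumes "finite G" "linear_quotients F"
    and "\<And>S T. S \<in> G \<Longrightarrow> T \<in> F \<union> G \<Longrightarrow> S \<notin> F \<Longrightarrow> T \<noteq> S \<Longrightarrow>
      (\<exists>x. T - S = {x}) \<or> (\<exists>S'\<in>F. \<exists>x\<in>T. S' - S = {x})"
  shows "linear_quotients (F \<union> G)"
  using assms(1,3)
proof (induction G rule: finite_induct)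
  case empty
  then show ?case using assms(2) by simp
next
  case (insert S G)
  have IH: "linear_quotients (F \<union> G)"
    by (rule insert.IH) (use insert.prems in blast)
  show ?case
  proof (cases "S \<in> F")
    case True
    then have "F \<union> insert S G = F \<union> G" by blast
    with IH show ?thesis by simp
  next
    case False
    have "\<exists>S'\<in>F \<union> G. \<exists>x\<in>T. S' - S = {x}" if T: "T \<in> F \<union> G" for T
    proof -
      have "T \<noteq> S" using T False insert.hyps by auto
      then have "(\<exists>x. T - S = {x}) \<or> (\<exists>S'\<in>F. \<exists>x\<in>T. S' - S = {x})"
        using insert.prems[of S T] T False by blast
      then show ?thesis
      proof
        assume "\<exists>x. T - S = {x}"
        then obtain x where "T - S = {x}" by blast
        moreover from this have "x \<in> T" by blast
        ultimately show ?thesis using T by blast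
      qed blast
    qed
    then have "linear_quotients ((F \<union> G) \<union> {S})"
      using False insert.hyps
      by (intro linear_quotients_Un[OF IH linear_quotients_singleton]) auto
    then show ?thesis by simp
  qed
qed

definition interval_sets :: "'a set \<Rightarrow> 'a set \<Rightarrow> nat \<Rightarrow> 'a set set" where
  "interval_sets P U k = {S. P \<subseteq> S \<and> S \<subseteq> P \<union> U \<and> card S = k}"

lemma card_exchange:
  assumes "finite S" "y \<in> S" "v \<notin> S"
  shows "card (insert v (S - {y})) = card S"
  using assms card_Suc_Diff1[of S y] by simp

text \<open>Here every exchange is possible, so any vertex can be split off. The splitting ends when
  \<open>P\<close> leaves at most one set.\<close>

lemma linear_quotients_interval_sets:
  assumes "finite U" "finite P" "P \<inter> U = {}"
  shows "linear_quotients (interval_sets P U k)"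
  using assms
proof (induction U arbitrary: P rule: finite_induct)
  case empty
  then have "interval_sets P {} k = (if card P = k then {P} else {})"
    by (auto simp: interval_sets_def)
  then show ?case by (simp add: linear_quotients_empty linear_quotients_singleton)
next
  case (insert v U)
  let ?F = "interval_sets P (insert v U) k"
  show ?case
  proof (cases "card P < k")
    case False
    have "S = P" if "S \<in> ?F" for S
    proof -
      from that have S: "P \<subseteq> S" "S \<subseteq> P \<union> insert v U" "card S = k"
        by (auto simp: interval_sets_def)
      then have "finite S" using insert.prems insert.hyps by (meson finite.insertI finite_Un finite_subset)
      with S False show "S = P" by (metis card_seteq not_less)
    qed
    then have "?F = {} \<or> ?F = {P}" by blast
    then show ?thesis using linear_quotients_empty linear_quotients_singleton by metis
  next
    case True
    have v: "v \<notin> P" using insert.prems by auto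
    show ?thesis
    proof (rule linear_quotients_split[where v = v])
      have "{S \<in> ?F. v \<in> S} = interval_sets (insert v P) U k"
        using v by (auto simp: interval_sets_def)
      then show "linear_quotients {S \<in> ?F. v \<in> S}"
        using insert by simp
      have "{S \<in> ?F. v \<notin> S} = interval_sets P U k"
        using v insert.hyps by (auto simp: interval_sets_def)
      then show "linear_quotients {S \<in> ?F. v \<notin> S}"
        using insert by simp
    next
      fix S assume S: "S \<in> ?F" "v \<notin> S"
      then have sub: "P \<subseteq> S" "S \<subseteq> P \<union> insert v U" "card S = k"
        by (auto simp: interval_sets_def)
      then have fin: "finite S"
        using insert.prems insert.hyps by (meson finite.insertI finite_Un finite_subset)
      from True sub obtain y where y: "y \<in> S" "y \<notin> P" by (metis less_irrefl subsetI subset_antisym)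
      have "card (insert v (S - {y})) = k" using card_exchange[OF fin y(1) S(2)] sub by simp
      with y sub S have "insert v (S - {y}) \<in> ?F" unfolding interval_sets_def by blast
      with y show "\<exists>y\<in>S. insert v (S - {y}) \<in> ?F" by blast
    qed
  qed
qed

text \<open>The sets avoiding \<open>Z\<close> come first. A later \<open>S\<close> has exactly one element \<open>z\<close> in \<open>Z\<close>, and
  replacing \<open>z\<close> by any \<open>x\<close> outside of \<open>Z\<close> leads back to them. If \<open>T\<close> offers no such
  \<open>x\<close>, then \<open>T - S\<close> lies in \<open>Z\<close> and is therefore a single element.\<close>

lemma linear_quotients_almost_interval:
  assumes fin: "finite U" "finite P" and dis: "P \<inter> U = {}" "P \<inter> Z = {}"
    and upper: "F \<subseteq> interval_sets P U k"
    and lower: "interval_sets P (U - Z) k \<subseteq> F"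
    and one: "\<And>S u w. S \<in> F \<Longrightarrow> u \<in> S \<inter> Z \<Longrightarrow> w \<in> S \<inter> Z \<Longrightarrow> u = w"
  shows "linear_quotients F"
proof -
  let ?G = "interval_sets P (U - Z) k"
  have finS: "finite S" if "S \<in> F" for S
    using that upper fin by (auto simp: interval_sets_def intro: finite_subset)
  have "F \<subseteq> Pow (P \<union> U)" using upper by (auto simp: interval_sets_def)
  then have "finite F" using fin by (meson finite_Pow_iff finite_Un finite_subset)
  moreover have "linear_quotients ?G"
    by (rule linear_quotients_interval_sets) (use fin dis in auto)
  ultimately have "linear_quotients (?G \<union> F)"
  proof (rule linear_quotients_extend)
    fix S T assume S: "S \<in> F" "S \<notin> ?G" and "T \<in> ?G \<union> F" and "T \<noteq> S"
    with lower have T: "T \<in> F" by blast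
    have Sk: "P \<subseteq> S" "S \<subseteq> P \<union> U" "card S = k" using S upper by (auto simp: interval_sets_def)
    have Tk: "T \<subseteq> P \<union> U" "card T = k" using T upper by (auto simp: interval_sets_def)
    from S(2) Sk obtain z where z: "z \<in> S" "z \<in> Z" by (auto simp: interval_sets_def)
    have "\<not> T \<subseteq> S" using finS[OF S(1)] Sk Tk \<open>T \<noteq> S\<close> by (metis card_subset_eq)
    show "(\<exists>x. T - S = {x}) \<or> (\<exists>S'\<in>?G. \<exists>x\<in>T. S' - S = {x})"
    proof (cases "T - S \<subseteq> Z")
      case True
      with \<open>\<not> T \<subseteq> S\<close> one[OF T] have "\<exists>x. T - S = {x}" by blast
      then show ?thesis ..
    next
      case False
      then obtain x where x: "x \<in> T" "x \<notin> S" "x \<notin> Z" by blast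
      let ?S = "insert x (S - {z})"
      have "card ?S = k" using card_exchange[OF finS[OF S(1)] z(1) x(2)] Sk by simp
      moreover have "P \<subseteq> ?S" using Sk z dis by blast
      moreover have "?S \<subseteq> P \<union> (U - Z)" using Sk Tk x z one[OF S(1)] by blast
      ultimately have "?S \<in> ?G" unfolding interval_sets_def by blast
      moreover have "?S - S = {x}" using x by blast
      ultimately show ?thesis using x by blast
    qed
  qed
  moreover have "?G \<union> F = F" using lower by blast
  ultimately show ?thesis by simp
qed

text \<open>A facet of \<open>(\<Union>s<j. simplex F\<^sub>s) \<inter> simplex F\<^sub>j\<close> lies in some \<open>F\<^sub>i \<inter> F\<^sub>j\<close>, hence
  in a face \<open>F\<^sub>j - {x}\<close> of the same complex, and equals this face by maximality.\<close>

lemma shellable_of_linear_quotients: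
  assumes K: "simplicial_complex K" and fin: "finite V"
    and facets: "facets K = (\<lambda>S. V - S) ` F" and F: "F \<subseteq> Pow V" and lq: "linear_quotients F"
  shows "shellable K"
proof -
  obtain Ss where Ss: "distinct Ss" "set Ss = F"
    and ex: "\<And>i j. j < length Ss \<Longrightarrow> i < j \<Longrightarrow> \<exists>l<j. \<exists>x\<in>Ss ! i. Ss ! l - Ss ! j = {x}"
    using lq unfolding linear_quotients_def by blast
  let ?Fs = "map (\<lambda>S. V - S) Ss"
  have "inj_on (\<lambda>S. V - S) F" using F by (intro inj_onI) blast
  then have "distinct ?Fs" using Ss by (simp add: distinct_map)
  moreover have "set ?Fs = facets K" using Ss facets by simp
  moreover have "pure_of_dim (simplex_dim (?Fs ! j) - 1) ((\<Union>s<j. simplex (?Fs ! s)) \<inter> simplex (?Fs ! j))"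
    if j: "1 \<le> j" "j < length ?Fs" for j
  proof -
    let ?K = "(\<Union>s<j. simplex (?Fs ! s)) \<inter> simplex (?Fs ! j)"
    have nth: "?Fs ! s = V - Ss ! s" if "s \<le> j" for s using that j by simp
    have sub: "Ss ! s \<subseteq> V" if "s \<le> j" for s
    proof -
      have "Ss ! s \<in> F" using that j Ss(2) by auto
      with F show ?thesis by blast
    qed
    have "{} \<in> ?K" using j by (auto intro: exI[of _ 0])
    moreover have "simplex_dim \<sigma> = simplex_dim (?Fs ! j) - 1" if "\<sigma> \<in> facets ?K" for \<sigma>
    proof -
      from that have \<sigma>: "\<sigma> \<in> ?K" "\<And>\<tau>. \<tau> \<in> ?K \<Longrightarrow> \<sigma> \<subseteq> \<tau> \<Longrightarrow> \<tau> = \<sigma>" by (auto simp: facets_def)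
      then obtain i where i: "i < j" "\<sigma> \<subseteq> ?Fs ! i" "\<sigma> \<subseteq> ?Fs ! j" by auto
      obtain l x where l: "l < j" "x \<in> Ss ! i" "Ss ! l - Ss ! j = {x}" using ex[OF _ i(1)] j by auto
      have x: "x \<in> V - Ss ! j" using l sub[of l] by auto
      let ?\<tau> = "V - Ss ! j - {x}"
      have "?\<tau> \<subseteq> V - Ss ! l" using l(3) by blast
      then have "?\<tau> \<in> ?K" using l(1) nth[of l] nth[of j] by auto
      moreover have "\<sigma> \<subseteq> ?\<tau>" using i l(2) nth[of i] nth[of j] by auto
      ultimately have "\<sigma> = ?\<tau>" using \<sigma>(2) by blast
      moreover have "card (V - Ss ! j) > 0" using x fin by (auto simp: card_gt_0_iff)
      ultimately show ?thesis using x fin nth[of j] by (simp add: simplex_dim_def of_nat_diff)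
    qed
    ultimately show ?thesis unfolding pure_of_dim_def by blast
  qed
  ultimately have "shelling K ?Fs" unfolding shelling_def by blast
  with K show ?thesis unfolding shellable_def by blast
qed

section \<open>Separations in the ladder\<close>

fun grid_adj :: "grid_vertex \<Rightarrow> grid_vertex \<Rightarrow> bool" where
  "grid_adj (A i) (A j) \<longleftrightarrow> j = Suc i \<or> i = Suc j"
| "grid_adj (B i) (B j) \<longleftrightarrow> j = Suc i \<or> i = Suc j"
| "grid_adj (A i) (B j) \<longleftrightarrow> i = j"
| "grid_adj (B i) (A j) \<longleftrightarrow> i = j"

fun col :: "grid_vertex \<Rightarrow> nat" where
  "col (A i) = i"
| "col (B i) = i"

fun right :: "grid_vertex \<Rightarrow> grid_vertex" where
  "right (A i) = A (Suc i)"
| "right (B i) = B (Suc i)"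

fun opposite :: "grid_vertex \<Rightarrow> grid_vertex" where
  "opposite (A i) = B i"
| "opposite (B i) = A i"

lemma grid_adj_sym: "grid_adj u v \<longleftrightarrow> grid_adj v u"
  by (cases u; cases v) auto

text \<open>Both connectedness and disconnectedness of vertex sets are used only through partitions
  without edges between the two parts, which are easy to modify when a vertex is exchanged.\<close>

definition separation :: "grid_vertex set \<Rightarrow> grid_vertex set \<Rightarrow> grid_vertex set \<Rightarrow> bool" where
  "separation S X Y \<longleftrightarrow> X \<noteq> {} \<and> Y \<noteq> {} \<and> X \<union> Y = S \<and> X \<inter> Y = {} \<and>
     (\<forall>x\<in>X. \<forall>y\<in>Y. \<not> grid_adj x y)"

definition separated :: "grid_vertex set \<Rightarrow> bool" where
  "separated S \<longleftrightarrow> (\<exists>X Y. separation S X Y)"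

lemma separation_sym: "separation S X Y \<longleftrightarrow> separation S Y X"
  unfolding separation_def using grid_adj_sym by blast

lemma separated_iff_not_connected:
  assumes S: "S \<subseteq> verts (grid_2xn n)" "S \<noteq> {}"
  shows "separated S \<longleftrightarrow> \<not> connected (grid_2xn n \<restriction> S)"
proof -
  let ?r = "{(u, v). u \<in> S \<and> v \<in> S \<and> grid_adj u v}"
  have V: "verts (grid_2xn n) = A ` {1..n} \<union> B ` {1..n}"
    by (simp add: grid_2xn_def)
  have edge: "(u, v) \<in> grid_edges n \<union> (grid_edges n)\<inverse> \<longleftrightarrow> grid_adj u v"
    if "u \<in> verts (grid_2xn n)" "v \<in> verts (grid_2xn n)" for u v
    using that unfolding V by (cases u; cases v) (auto simp: grid_edges_def)
  have "arcs_ends (mk_symmetric (grid_2xn n \<restriction> S)) =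
      {(u, v). u \<in> S \<and> v \<in> S \<and> (u, v) \<in> grid_edges n \<union> (grid_edges n)\<inverse>}"
    by (auto simp: parcs_mk_symmetric grid_2xn_def)
  also have "\<dots> = ?r" using edge S(1) by blast
  finally have ends: "arcs_ends (mk_symmetric (grid_2xn n \<restriction> S)) = ?r" .
  have reach: "u \<rightarrow>\<^sup>*\<^bsub>mk_symmetric (grid_2xn n \<restriction> S)\<^esub> v \<longleftrightarrow> (u, v) \<in> rtrancl_on S ?r" for u v
    unfolding reachable_def ends by simp
  have conn: "connected (grid_2xn n \<restriction> S) \<longleftrightarrow> (\<forall>u\<in>S. \<forall>v\<in>S. (u, v) \<in> rtrancl_on S ?r)"
    unfolding connected_def strongly_connected_def reach using S(2) by simp
  show ?thesis
  proof
    assume "separated S"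
    then obtain X Y where XY: "separation S X Y" unfolding separated_def by blast
    then obtain u w where uw: "u \<in> X" "w \<in> Y" unfolding separation_def by blast
    have "v \<in> X" if "(u, v) \<in> rtrancl_on S ?r" for v
      using that
    proof (induction rule: rtrancl_on_induct)
      case base
      then show ?case using uw by simp
    next
      case (step y z)
      then show ?case using XY unfolding separation_def by blast
    qed
    with uw XY show "\<not> connected (grid_2xn n \<restriction> S)"
      unfolding conn separation_def by blast
  next
    assume "\<not> connected (grid_2xn n \<restriction> S)"
    then obtain u w where uw: "u \<in> S" "w \<in> S" "(u, w) \<notin> rtrancl_on S ?r"
      unfolding conn by blast
    let ?X = "{v \<in> S. (u, v) \<in> rtrancl_on S ?r}"
    have "\<not> grid_adj x y" if "x \<in> ?X" "y \<in> S - ?X" for x y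
      using that rtrancl_on_into_rtrancl_on[of u x S ?r y] by blast
    then have "separation S ?X (S - ?X)" unfolding separation_def using uw by blast
    then show "separated S" unfolding separated_def by blast
  qed
qed

lemma not_separated_empty: "\<not> separated {}"
  by (auto simp: separated_def separation_def)

text \<open>Connected sets arise only by adding to a connected set a vertex adjacent to it.\<close>

lemma not_separated_insert:
  assumes "\<not> separated W" "W = {} \<or> (\<exists>w\<in>W. grid_adj w v)"
  shows "\<not> separated (insert v W)"
proof
  assume "separated (insert v W)"
  then obtain X Y where XY: "separation (insert v W) X Y" and v: "v \<in> X"
  proof -
    assume "separated (insert v W)"
    then obtain X Y where "separation (insert v W) X Y" unfolding separated_def by blast
    moreover from this have "separation (insert v W) Y X" by (simp add: separation_sym)
    moreover have "v \<in> X \<union> Y" using calculation(1) unfolding separation_def by simp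
    ultimately show thesis using that by blast
  qed
  have XYD: "X \<union> Y = insert v W" "X \<inter> Y = {}" "Y \<noteq> {}"
    "\<And>x y. x \<in> X \<Longrightarrow> y \<in> Y \<Longrightarrow> \<not> grid_adj x y"
    using XY unfolding separation_def by simp_all
  show False
  proof (cases "v \<in> W \<or> W = {}")
    case True
    then show ?thesis
    proof
      assume "v \<in> W"
      with XY assms(1) show False unfolding separated_def by (metis insert_absorb)
    next
      assume "W = {}"
      with XYD v show False by blast
    qed
  next
    case False
    with assms(2) obtain w where w: "w \<in> W" "grid_adj w v" by blast
    have "w \<notin> Y" using w v XYD(4)[of v w] grid_adj_sym[of v w] by blast
    with w XYD(1) False have "w \<in> X - {v}" by blast
    moreover have "(X - {v}) \<union> Y = W" using XYD(1,2) v False by blast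
    ultimately have "separation W (X - {v}) Y" unfolding separation_def using XYD by blast
    with assms(1) show False unfolding separated_def by blast
  qed
qed

lemma not_separated_subset:
  assumes "separation S X Y" "W \<subseteq> S" "\<not> separated W"
  shows "W \<subseteq> X \<or> W \<subseteq> Y"
proof (rule ccontr)
  assume "\<not> (W \<subseteq> X \<or> W \<subseteq> Y)"
  with assms have "separation W (W \<inter> X) (W \<inter> Y)" unfolding separation_def by blast
  with assms(3) show False unfolding separated_def by blast
qed

lemma grid_adj_leftD:
  assumes "grid_adj v w" "col v \<le> m" "m < col w"
  shows "col v = m \<and> w = right v"
  using assms by (cases v; cases w) auto

lemma grid_adj_right_opposite: "grid_adj v (right v)" "grid_adj (right v) (right (opposite v))"
  by (cases v; simp)+

lemma same_col: "col v = col w \<Longrightarrow> w = v \<or> w = opposite v"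
  by (cases v; cases w) auto

text \<open>Let \<open>W\<close> be the part of \<open>S\<close> up to the column of \<open>v\<close>. Being connected, it lies on one
  side \<open>X\<close> of a separation of \<open>S\<close> into \<open>X\<close> and \<open>Y\<close>. If the right neighbour of \<open>v\<close> is
  in \<open>Y\<close>, it is the vertex to remove. Otherwise \<open>v\<close> has no neighbour in \<open>Y\<close>, so \<open>v\<close> may
  join \<open>X\<close>, and any vertex to the right may be removed unless it is all of \<open>Y\<close>.\<close>

lemma separated_exchange:
  assumes sep: "separated S" and fin: "finite S" and v: "v \<notin> S"
    and W: "\<not> separated {u \<in> S. col u \<le> col v}"
    and two: "2 \<le> card {u \<in> S. col v < col u}"
  shows "\<exists>y\<in>S. col v < col y \<and> separated (insert v (S - {y}))"
proof -
  let ?W = "{u \<in> S. col u \<le> col v}" and ?R = "{u \<in> S. col v < col u}"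
  obtain X Y where XY: "separation S X Y" and WX: "?W \<subseteq> X"
  proof -
    obtain X Y where XY: "separation S X Y" using sep unfolding separated_def by blast
    from not_separated_subset[OF XY _ W] have "?W \<subseteq> X \<or> ?W \<subseteq> Y" by blast
    with XY that show thesis using separation_sym by blast
  qed
  have XYD: "X \<union> Y = S" "X \<inter> Y = {}" "X \<noteq> {}" "Y \<noteq> {}" "\<And>x y. x \<in> X \<Longrightarrow> y \<in> Y \<Longrightarrow> \<not> grid_adj x y"
    using XY unfolding separation_def by blast+
  have other: "\<exists>u\<in>T. u \<noteq> y" if "2 \<le> card T" for T and y :: grid_vertex
  proof (rule ccontr)
    assume "\<not> (\<exists>u\<in>T. u \<noteq> y)"
    then have "T \<subseteq> {y}" by blast
    then have "card T \<le> 1" using card_mono[of "{y}" T] by simp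
    with that show False by simp
  qed
  show ?thesis
  proof (cases "right v \<in> Y")
    case True
    let ?y = "right v"
    have cy: "col v < col ?y" by (cases v) auto
    \<comment> \<open>The only possible way from \<open>W\<close> to the right leads from the vertex opposite to \<open>v\<close> to its
      right neighbour \<open>u\<close>. But \<open>u\<close> would then be in \<open>X\<close> and adjacent to \<open>right v\<close> in \<open>Y\<close>.\<close>
    have cut: "\<not> grid_adj w u" if w: "w \<in> ?W" and u: "u \<in> ?R" for w u
    proof
      assume adj: "grid_adj w u"
      with w u have "col w = col v" "u = right w" using grid_adj_leftD by blast+
      moreover from this w v have "w = opposite v" using same_col[of v w] by auto
      ultimately have "grid_adj u ?y" using grid_adj_right_opposite(2) grid_adj_sym by metis
      moreover have "u \<in> X" using adj w u WX XYD by blast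
      ultimately show False using True XYD by blast
    qed
    have cutv: "\<not> grid_adj v u" if "u \<in> ?R - {?y}" for u
      using that grid_adj_leftD[of v u "col v"] by auto
    obtain u where "u \<in> ?R - {?y}" using other[OF two, of ?y] by blast
    then have "separation (insert v (S - {?y})) (insert v ?W) (?R - {?y})"
      unfolding separation_def using cut cutv v cy by fastforce
    moreover have "?y \<in> S" using True XYD by blast
    ultimately show ?thesis unfolding separated_def using cy by blast
  next
    case False
    have cutv: "\<not> grid_adj v u" if u: "u \<in> Y" for u
    proof
      assume adj: "grid_adj v u"
      have "u \<in> S" "u \<notin> ?W" using u XYD WX by blast+
      then have "u = right v" using grid_adj_leftD[OF adj, of "col v"] by simp
      with u False show False by blast
    qed
    have sepX: "separation (insert v (S - {y})) (insert v (X - {y})) (Y - {y})"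
      if "y \<in> S" "Y - {y} \<noteq> {}" for y
      unfolding separation_def using that XYD cutv v by blast
    show ?thesis
    proof (cases "X = ?W")
      case False
      with WX obtain y where y: "y \<in> X" "y \<notin> ?W" by blast
      then have "y \<in> S" "Y - {y} \<noteq> {}" "col v < col y" using XYD by auto
      with sepX show ?thesis unfolding separated_def by blast
    next
      case True
      \<comment> \<open>All removable vertices are in \<open>Y\<close> now, and there are two of them.\<close>
      then have "Y = S - ?W" using XYD by blast
      then have "Y = ?R" by auto
      moreover obtain y where y: "y \<in> ?R" using other[OF two] by blast
      moreover have "?R - {y} \<noteq> {}" using other[OF two, of y] by blast
      ultimately have "y \<in> S" "Y - {y} \<noteq> {}" "col v < col y" by auto
      with sepX show ?thesis unfolding separated_def by blast
    qed
  qed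
qed

section \<open>Ordering the separated sets of the ladder\<close>

text \<open>The sets compatible with the decisions made so far: the columns up to \<open>i\<close> are decided, and
  \<open>P\<close> consists of the vertices chosen there.\<close>

definition separated_sets :: "nat \<Rightarrow> nat \<Rightarrow> nat \<Rightarrow> grid_vertex set \<Rightarrow> grid_vertex set set" where
  "separated_sets n k i P = {S. S \<subseteq> verts (grid_2xn n) \<and> card S = k \<and> separated S \<and>
     {u \<in> S. col u \<le> i} = P}"

lemma in_verts_grid: "v \<in> verts (grid_2xn n) \<longleftrightarrow> 1 \<le> col v \<and> col v \<le> n"
  by (cases v) (auto simp: grid_2xn_def)

lemma finite_verts_grid: "finite (verts (grid_2xn n))"
  by (simp add: grid_2xn_def)

lemma finite_subset_verts_grid: "S \<subseteq> verts (grid_2xn n) \<Longrightarrow> finite S"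
  using finite_verts_grid by (rule rev_finite_subset)

text \<open>With the right neighbours of \<open>P\<close> as \<open>Z\<close>, a set avoiding \<open>Z\<close> is separated into \<open>P\<close>
  and the rest, which is nonempty by \<open>card P < k\<close>. The set \<open>Z\<close> has two elements only if
  column \<open>i\<close> is full, and then the last assumption prevents a separated \<open>k\<close>-set from containing
  both: it would have to consist of \<open>P\<close> and these two vertices.\<close>

lemma linear_quotients_right_neighbours:
  assumes P: "P \<noteq> {}" "finite P" "\<And>u. u \<in> P \<Longrightarrow> col u \<le> i" and k: "card P < k"
    and Pn: "P \<subseteq> verts (grid_2xn n)"
    and once: "A i \<in> P \<Longrightarrow> B i \<in> P \<Longrightarrow>
      k \<le> card P + 2 \<and> \<not> separated (insert (A (Suc i)) (insert (B (Suc i)) P))"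
  shows "linear_quotients (separated_sets n k i P)"
proof -
  let ?Z = "right ` {u \<in> P. col u = i}"
  let ?U = "{u \<in> verts (grid_2xn n). i < col u}"
  have cr: "col (right u) = Suc (col u)" for u by (cases u) auto
  show ?thesis
  proof (rule linear_quotients_almost_interval[where P = P and U = ?U and Z = ?Z])
    show "finite ?U" using finite_verts_grid by simp
    show "P \<inter> ?U = {}" using P(3) by fastforce
    show "P \<inter> ?Z = {}" using P(3) cr by fastforce
    show "separated_sets n k i P \<subseteq> interval_sets P ?U k"
      by (auto simp: separated_sets_def interval_sets_def)
    show "interval_sets P (?U - ?Z) k \<subseteq> separated_sets n k i P"
    proof
      fix S assume "S \<in> interval_sets P (?U - ?Z) k"
      then have S: "P \<subseteq> S" "S \<subseteq> P \<union> (?U - ?Z)" "card S = k" by (auto simp: interval_sets_def)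
      have left: "{u \<in> S. col u \<le> i} = P" using S P(3) by auto
      have "S \<noteq> P" using S k by auto
      moreover have "\<not> grid_adj u w" if "u \<in> P" "w \<in> S - P" for u w
        using that S P(3) grid_adj_leftD[of u w i] by fastforce
      ultimately have "separation S P (S - P)" unfolding separation_def using S P by blast
      then show "S \<in> separated_sets n k i P"
        unfolding separated_sets_def separated_def using S left Pn by auto
    qed
  next
    fix S u w assume S: "S \<in> separated_sets n k i P" and u: "u \<in> S \<inter> ?Z" and w: "w \<in> S \<inter> ?Z"
    show "u = w"
    proof (rule ccontr)
      assume "u \<noteq> w"
      from u w obtain u' w' where uw: "u = right u'" "w = right w'" "u' \<in> P" "w' \<in> P" "col u' = i" "col w' = i"
        by blast
      with \<open>u \<noteq> w\<close> have both: "A i \<in> P" "B i \<in> P" "A (Suc i) \<in> S" "B (Suc i) \<in> S"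
        using u w by (cases u'; cases w'; auto)+
      let ?T = "insert (A (Suc i)) (insert (B (Suc i)) P)"
      have new: "A (Suc i) \<notin> P" "B (Suc i) \<notin> P" using P(3) by fastforce+
      then have "card ?T = card P + 2" using P(2) by simp
      moreover have "?T \<subseteq> S" "card S = k" "finite S" "separated S"
        using S both finite_subset_verts_grid by (auto simp: separated_sets_def)
      ultimately have "?T = S" using once[OF both(1,2)] by (intro card_seteq) auto
      with once[OF both(1,2)] \<open>separated S\<close> show False by blast
    qed
  qed (use P in auto)
qed

text \<open>Both vertices of column \<open>i + 1\<close> can be split off one after the other. For either of them, the
  part of \<open>S\<close> up to this column is \<open>P\<close>, possibly together with the other vertex of the column.
  This is connected and has at most \<open>card P + 1\<close> elements, which leaves two further to the
  right. The removed vertex lies beyond column \<open>i + 1\<close>, so an exchange for the second vertex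
  respects the decision about the first.\<close>

lemma linear_quotients_next_column:
  assumes P: "\<And>u. u \<in> P \<Longrightarrow> col u \<le> i" and i: "i < n" and k: "card P + 3 \<le> k"
    and connP: "\<not> separated P" "P = {} \<or> A i \<in> P \<and> B i \<in> P"
    and next_cols: "linear_quotients (separated_sets n k (Suc i) (insert (A (Suc i)) (insert (B (Suc i)) P)))"
      "linear_quotients (separated_sets n k (Suc i) (insert (A (Suc i)) P))"
      "linear_quotients (separated_sets n k (Suc i) (insert (B (Suc i)) P))"
      "linear_quotients (separated_sets n k (Suc i) P)"
  shows "linear_quotients (separated_sets n k i P)"
proof -
  let ?a = "A (Suc i)" and ?b = "B (Suc i)" and ?F = "separated_sets n k i P"
  have le_Suc: "{u \<in> S. col u \<le> Suc i} = {u \<in> S. col u \<le> i} \<union> (S \<inter> {?a, ?b})" for S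
  proof -
    have "col u \<le> Suc i \<longleftrightarrow> col u \<le> i \<or> u = ?a \<or> u = ?b" for u by (cases u) auto
    then show ?thesis by auto
  qed
  have new: "?a \<notin> P" "?b \<notin> P" using P by fastforce+
  have exch: "\<exists>y\<in>S. Suc i < col y \<and> insert v (S - {y}) \<in> ?F"
    if S: "S \<in> ?F" "v \<notin> S" and v: "v = ?a \<or> v = ?b" for S v
  proof -
    have SD: "S \<subseteq> verts (grid_2xn n)" "card S = k" "separated S" "{u \<in> S. col u \<le> i} = P"
      using S by (auto simp: separated_sets_def)
    have fin: "finite S" using SD finite_subset_verts_grid by blast
    have cv: "col v = Suc i" using v by auto
    let ?W = "{u \<in> S. col u \<le> col v}"
    have W: "?W = P \<or> ?W = insert (opposite v) P"
    proof -
      have "?W = P \<union> (S \<inter> {?a, ?b})" using le_Suc[of S] SD(4) cv by simp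
      moreover have "S \<inter> {?a, ?b} = {} \<or> S \<inter> {?a, ?b} = {opposite v}"
        using v S(2) by auto
      ultimately show ?thesis by auto
    qed
    have adj: "P = {} \<or> (\<exists>w\<in>P. grid_adj w (opposite v))"
      using connP(2) v by force
    have "\<not> separated ?W"
      using W connP(1) not_separated_insert[OF connP(1) adj] by metis
    moreover have "2 \<le> card {u \<in> S. col v < col u}"
    proof -
      have "finite P" using fin SD(4) by auto
      then have "card ?W \<le> card P + 1" using W by (auto simp: card_insert_if)
      moreover have "{u \<in> S. col v < col u} = S - ?W" by auto
      moreover have "card (S - ?W) = card S - card ?W" using fin by (intro card_Diff_subset) auto
      ultimately show ?thesis using k SD(2) by simp
    qed
    ultimately obtain y where y: "y \<in> S" "Suc i < col y" "separated (insert v (S - {y}))"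
      using separated_exchange[OF SD(3) fin S(2)] cv by auto
    have "insert v (S - {y}) \<in> ?F"
      using SD y cv i fin S(2) card_exchange[OF fin y(1) S(2)]
      by (auto simp: separated_sets_def in_verts_grid)
    with y show ?thesis by blast
  qed
  have refine: "{S \<in> ?F. S \<inter> {?a, ?b} = Q} = separated_sets n k (Suc i) (Q \<union> P)"
    if Q: "Q \<subseteq> {?a, ?b}" for Q
  proof -
    \<comment> \<open>Decided and new vertices can be told apart, so the two conditions merge into one union.\<close>
    have old_new: "L = P \<and> M = Q \<longleftrightarrow> L \<union> M = Q \<union> P"
      if "L \<inter> X = {}" "P \<inter> X = {}" "M \<subseteq> X" "Q \<subseteq> X" for L M X :: "grid_vertex set"
    proof
      assume "L \<union> M = Q \<union> P"
      then have "(L \<union> M) - X = (Q \<union> P) - X" "(L \<union> M) \<inter> X = (Q \<union> P) \<inter> X" by simp_all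
      moreover have "(L \<union> M) - X = L" "(Q \<union> P) - X = P" "(L \<union> M) \<inter> X = M" "(Q \<union> P) \<inter> X = Q"
        using that by blast+
      ultimately show "L = P \<and> M = Q" by simp
    qed blast
    have "{u \<in> S. col u \<le> i} = P \<and> S \<inter> {?a, ?b} = Q \<longleftrightarrow> {u \<in> S. col u \<le> Suc i} = Q \<union> P" for S
      unfolding le_Suc
    proof (rule old_new)
      show "{u \<in> S. col u \<le> i} \<inter> {?a, ?b} = {}" by auto
      show "P \<inter> {?a, ?b} = {}" using new by blast
    qed (use Q in blast)+
    then show ?thesis by (simp only: separated_sets_def mem_Collect_eq conj_assoc)
  qed
  show ?thesis
  proof (rule linear_quotients_split[where v = ?a])
    show "linear_quotients {S \<in> ?F. ?a \<in> S}"
    proof (rule linear_quotients_split[where v = ?b])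
      have "{S \<in> {S \<in> ?F. ?a \<in> S}. ?b \<in> S} = {S \<in> ?F. S \<inter> {?a, ?b} = {?a, ?b}}" by blast
      then show "linear_quotients {S \<in> {S \<in> ?F. ?a \<in> S}. ?b \<in> S}"
        using refine[of "{?a, ?b}"] next_cols by simp
      have "{S \<in> {S \<in> ?F. ?a \<in> S}. ?b \<notin> S} = {S \<in> ?F. S \<inter> {?a, ?b} = {?a}}" by blast
      then show "linear_quotients {S \<in> {S \<in> ?F. ?a \<in> S}. ?b \<notin> S}"
        using refine[of "{?a}"] next_cols by simp
    next
      fix S assume "S \<in> {S \<in> ?F. ?a \<in> S}" "?b \<notin> S"
      then show "\<exists>y\<in>S. insert ?b (S - {y}) \<in> {S \<in> ?F. ?a \<in> S}"
        using exch[of S ?b] by fastforce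
    qed
    show "linear_quotients {S \<in> ?F. ?a \<notin> S}"
    proof (rule linear_quotients_split[where v = ?b])
      have "{S \<in> {S \<in> ?F. ?a \<notin> S}. ?b \<in> S} = {S \<in> ?F. S \<inter> {?a, ?b} = {?b}}" by blast
      then show "linear_quotients {S \<in> {S \<in> ?F. ?a \<notin> S}. ?b \<in> S}"
        using refine[of "{?b}"] next_cols by simp
      have "{S \<in> {S \<in> ?F. ?a \<notin> S}. ?b \<notin> S} = {S \<in> ?F. S \<inter> {?a, ?b} = {}}" by blast
      then show "linear_quotients {S \<in> {S \<in> ?F. ?a \<notin> S}. ?b \<notin> S}"
        using refine[of "{}"] next_cols by simp
    next
      fix S assume "S \<in> {S \<in> ?F. ?a \<notin> S}" "?b \<notin> S"
      then show "\<exists>y\<in>S. insert ?b (S - {y}) \<in> {S \<in> ?F. ?a \<notin> S}"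
        using exch[of S ?b] by fastforce
    qed
  next
    fix S assume "S \<in> ?F" "?a \<notin> S"
    then show "\<exists>y\<in>S. insert ?a (S - {y}) \<in> ?F"
      using exch[of S ?a] by blast
  qed
qed

text \<open>Induction on the number of undecided columns. The invariant is that \<open>P\<close> is connected whenever
  column \<open>i\<close> is full; it is preserved because a full column is added only to the empty set or to
  a connected set in which the column before it is full.\<close>

lemma linear_quotients_separated_sets:
  assumes "3 \<le> k" and "i \<le> n" and "P \<subseteq> verts (grid_2xn n)" and "\<And>u. u \<in> P \<Longrightarrow> col u \<le> i"
    and "card P < k" and "A i \<in> P \<Longrightarrow> B i \<in> P \<Longrightarrow> \<not> separated P"
  shows "linear_quotients (separated_sets n k i P)"
  using assms(2-)
proof (induction "n - i" arbitrary: i P)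
  case 0
  have False if "S \<in> separated_sets n k i P" for S
  proof -
    from that have S: "S \<subseteq> verts (grid_2xn n)" "card S = k" "{u \<in> S. col u \<le> i} = P"
      by (auto simp: separated_sets_def)
    have "col u \<le> i" if "u \<in> S" for u
    proof -
      have "col u \<le> n" using that S(1) in_verts_grid by blast
      also have "n \<le> i" using "0.hyps" by simp
      finally show ?thesis .
    qed
    then have "{u \<in> S. col u \<le> i} = S" by blast
    with S "0.prems"(4) show False by simp
  qed
  then have "separated_sets n k i P = {}" by blast
  then show ?case by (simp add: linear_quotients_empty)
next
  case (Suc d)
  let ?a = "A (Suc i)" and ?b = "B (Suc i)"
  have i: "i < n" and d: "d = n - Suc i" using Suc.hyps by auto
  have fin: "finite P" using Suc.prems finite_subset_verts_grid by blast
  have new: "?a \<notin> P" "?b \<notin> P" using Suc.prems(3) by fastforce+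
  have conn: "\<not> separated (insert ?b P) \<and> \<not> separated (insert ?a (insert ?b P))"
    if "\<not> separated P" "P = {} \<or> A i \<in> P \<and> B i \<in> P"
  proof -
    have "P = {} \<or> (\<exists>w\<in>P. grid_adj w ?b)" using that(2) by force
    with that(1) have b: "\<not> separated (insert ?b P)" by (rule not_separated_insert)
    have "\<exists>w\<in>insert ?b P. grid_adj w ?a" by auto
    with b show ?thesis using not_separated_insert by blast
  qed
  \<comment> \<open>In the second case \<open>P\<close> is nonempty since \<open>3 \<le> k\<close>. Either column \<open>i\<close> is not full, or
    it is connected and at most two vertices are missing.\<close>
  show ?case
  proof (cases "(P = {} \<or> A i \<in> P \<and> B i \<in> P) \<and> card P + 3 \<le> k")
    case True
    have nsep: "\<not> separated P" using True Suc.prems(5) not_separated_empty by blast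
    have prems: "Suc i \<le> n" "?a \<in> verts (grid_2xn n)" "?b \<in> verts (grid_2xn n)"
      using i by (auto simp: in_verts_grid)
    have colP: "col u \<le> Suc i" if "u \<in> P" for u using Suc.prems(3)[OF that] by simp
    note IH = Suc.hyps(1)[OF d prems(1)]
    show ?thesis
    proof (rule linear_quotients_next_column)
      show "linear_quotients (separated_sets n k (Suc i) (insert ?a (insert ?b P)))"
        by (rule IH) (use Suc.prems prems colP True fin conn nsep in \<open>auto simp: card_insert_if\<close>)
      show "linear_quotients (separated_sets n k (Suc i) (insert ?a P))"
        by (rule IH) (use Suc.prems prems colP True fin new in \<open>auto simp: card_insert_if\<close>)
      show "linear_quotients (separated_sets n k (Suc i) (insert ?b P))"
        by (rule IH) (use Suc.prems prems colP True fin new in \<open>auto simp: card_insert_if\<close>)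
      show "linear_quotients (separated_sets n k (Suc i) P)"
        by (rule IH) (use Suc.prems prems colP new in auto)
    qed (use Suc.prems i True nsep in auto)
  next
    case False
    show ?thesis
    proof (rule linear_quotients_right_neighbours)
      show "P \<noteq> {}" using False assms(1) by auto
      show "k \<le> card P + 2 \<and> \<not> separated (insert ?a (insert ?b P))" if "A i \<in> P" "B i \<in> P"
        using that False conn Suc.prems(5) by auto
    qed (use Suc.prems fin in auto)
  qed
qed

section \<open>Shellability\<close>

theorem theorem1p2:
  fixes n k :: nat
  assumes "1 \<le> n" and "3 \<le> k" and "k \<le> 2 * n - 2"
  shows "shellable (cut_complex k (grid_2xn n))"
proof -
  let ?V = "verts (grid_2xn n)"
  let ?F = "{S. S \<subseteq> ?V \<and> card S = k \<and> \<not> connected (grid_2xn n \<restriction> S)}"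
  have sep: "separated S \<longleftrightarrow> \<not> connected (grid_2xn n \<restriction> S)" if "S \<subseteq> ?V" "card S = k" for S
  proof (rule separated_iff_not_connected)
    show "S \<noteq> {}" using that(2) assms(2) by force
  qed (fact that(1))
  \<comment> \<open>Columns are numbered from 1, so nothing is decided at column 0.\<close>
  have pos: "{u \<in> S. col u \<le> 0} = {}" if "S \<subseteq> ?V" for S
  proof -
    have "\<not> col u \<le> 0" if "u \<in> S" for u
      using \<open>S \<subseteq> ?V\<close> that in_verts_grid[of u n] by auto
    then show ?thesis by blast
  qed
  have "separated_sets n k 0 {} = ?F"
  proof -
    have "S \<subseteq> ?V \<and> card S = k \<and> separated S \<and> {u \<in> S. col u \<le> 0} = {} \<longleftrightarrow>
        S \<subseteq> ?V \<and> card S = k \<and> \<not> connected (grid_2xn n \<restriction> S)" for S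
      using sep[of S] pos[of S] by argo
    then show ?thesis unfolding separated_sets_def by presburger
  qed
  moreover have "linear_quotients (separated_sets n k 0 {})"
    using assms(2) by (intro linear_quotients_separated_sets) auto
  ultimately have lq: "linear_quotients ?F" by simp
  show ?thesis
  proof (rule shellable_of_linear_quotients)
    show "simplicial_complex (cut_complex k (grid_2xn n))"
      using finite_verts_grid by (rule simplicial_complex_cut_complex)
    show "facets (cut_complex k (grid_2xn n)) = (\<lambda>S. ?V - S) ` ?F"
      using finite_verts_grid by (rule facets_cut_complex)
    show "?F \<subseteq> Pow ?V" by blast
  qed (fact finite_verts_grid lq)+
qed

end
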